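(* Let $n>1$, $k_1,\dots,k_n\in\mathbb{Z}_{>0}$, and let $P=\min_{1\le j\le n,\,0\le i\le k_j}\{a_{i,j}+u_j^{(i)}\}$, $a_{i,j}\in\mathbb{Z}$, be a tropical linear differential equation in $n$ unknowns. Let $\mathcal{C}(P)$ be the family of supports of elements of $\mathcal{C}_{\mathbb{Z}_{\ge0}}(P)$, and let $L(P)$ be the set of $j\in[n]$ such that $\min_{0\le i\le k_j}\{a_{i,j}+k_j-i\}$ is attained for at least two values of $i$. Then $\mathcal{C}(P)$ is the set of circuits of a matroid $M(P)$ on the ground set $[n]$. Moreover, $$\mathcal{C}(P)=\{\{j\}: j\in L(P)\}\cup\binom{[n]\setminus L(P)}{2},$$ so $L(P)$ is the set of loops of $M(P)$.
   Context: $[n]=\{1,\dots,n\}$ and $\binom{E}{2}$ is the set of two-element subsets of $E$. For $S\subseteq\mathbb{Z}_{\ge0}$, $\mathrm{val}_S(i)=\min\{s-i: s\in S,\ s\ge i\}$, and $\infty$ if no such $s$ exists. A tuple $S=(S_1,\dots,S_n)$ of subsets of $\mathbb{Z}_{\ge0}$ is a solution of $P$ if $\min_{j,i}\{a_{i,j}+\mathrm{val}_{S_j}(i)\}$ is $\infty$ (only for $S=(\emptyset,\dots,\emptyset)$) or is attained for at least two index pairs $(i,j)$. $\mu(\mathrm{Sol}(P))$ is the set of nonzero (i.e. $\neq(\emptyset,\dots,\emptyset)$) solutions that are minimal for componentwise inclusion among nonzero solutions. $\mathcal{C}_{\mathbb{Z}_{\ge0}}(P)$ is the set of $S\in\mu(\mathrm{Sol}(P))$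 with $\mathrm{ord}(S_j)\ge k_j$ for all $j$, where $\mathrm{ord}(T)=\min T$, $\mathrm{ord}(\emptyset)=\infty$. The support of $S$ is $\mathrm{Supp}(S)=\{j: S_j\ne\emptyset\}$. *)

theory Defs
  imports "HOL-Library.Extended_Real" "HOL-Library.FuncSet"
begin

section \<open>Tropical linear differential equations\<close>

text \<open>
  An equation \<open>P = min {a i j + u\<^sub>j\<^sup>(\<^sup>i\<^sup>) | 1 \<le> j \<le> n, 0 \<le> i \<le> k j}\<close> is represented by its data
  \<open>n\<close>, \<open>k\<close>, \<open>a\<close>; only the values \<open>k j\<close> and \<open>a i j\<close> with \<open>(i, j)\<close> in the index set below matter.
  An \<open>n\<close>-tuple of subsets of \<open>\<nat>\<close> is an element of \<open>{1..n} \<rightarrow>\<^sub>E UNIV\<close>, so that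
  equality of tuples is equality of functions.
\<close>

definition index_pairs :: "nat \<Rightarrow> (nat \<Rightarrow> nat) \<Rightarrow> (nat \<times> nat) set" where
  "index_pairs n k = {(i, j). j \<in> {1..n} \<and> i \<in> {0..k j}}"

definition tuples :: "nat \<Rightarrow> (nat \<Rightarrow> nat set) set" where
  "tuples n = ({1..n} \<rightarrow>\<^sub>E UNIV)"

definition zero_tuple :: "nat \<Rightarrow> nat \<Rightarrow> nat set" where
  "zero_tuple n = (\<lambda>j\<in>{1..n}. {})"

definition tuple_le :: "nat \<Rightarrow> (nat \<Rightarrow> nat set) \<Rightarrow> (nat \<Rightarrow> nat set) \<Rightarrow> bool" where
  "tuple_le n S T \<longleftrightarrow> (\<forall>j\<in>{1..n}. S j \<subseteq> T j)"

definition supp :: "nat \<Rightarrow> (nat \<Rightarrow> nat set) \<Rightarrow> nat set" where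
  "supp n S = {j \<in> {1..n}. S j \<noteq> {}}"

text \<open>In the two infima below, the infimum of the empty set of type \<open>enat\<close> is \<open>\<infinity>\<close>.\<close>

definition val :: "nat set \<Rightarrow> nat \<Rightarrow> enat" where
  "val S i = (INF s\<in>{s \<in> S. i \<le> s}. enat (s - i))"

definition ord_set :: "nat set \<Rightarrow> enat" where
  "ord_set T = (INF t\<in>T. enat t)"

text \<open>Used for finite nonempty \<open>I\<close> only.\<close>

definition min_attained_twice :: "'i set \<Rightarrow> ('i \<Rightarrow> 'b::linorder) \<Rightarrow> bool" where
  "min_attained_twice I f \<longleftrightarrow> card {p \<in> I. f p = Min (f ` I)} \<ge> 2"

text \<open>The terms take values in \<open>\<int> \<union> {\<infinity>}\<close>, regarded as a subset of \<^typ>\<open>ereal\<close>.\<close>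

definition trop_term :: "(nat \<Rightarrow> nat \<Rightarrow> int) \<Rightarrow> (nat \<Rightarrow> nat set) \<Rightarrow> nat \<times> nat \<Rightarrow> ereal" where
  "trop_term a S = (\<lambda>(i, j). ereal (of_int (a i j)) + ereal_of_enat (val (S j) i))"

definition Sol :: "nat \<Rightarrow> (nat \<Rightarrow> nat) \<Rightarrow> (nat \<Rightarrow> nat \<Rightarrow> int) \<Rightarrow> (nat \<Rightarrow> nat set) set" where
  "Sol n k a = {S \<in> tuples n.
     Min (trop_term a S ` index_pairs n k) = \<infinity> \<or>
     min_attained_twice (index_pairs n k) (trop_term a S)}"

definition min_Sol :: "nat \<Rightarrow> (nat \<Rightarrow> nat) \<Rightarrow> (nat \<Rightarrow> nat \<Rightarrow> int) \<Rightarrow> (nat \<Rightarrow> nat set) set" where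
  "min_Sol n k a = {S \<in> Sol n k a. S \<noteq> zero_tuple n \<and>
     (\<forall>T \<in> Sol n k a. T \<noteq> zero_tuple n \<and> tuple_le n T S \<longrightarrow> T = S)}"

definition C_nat :: "nat \<Rightarrow> (nat \<Rightarrow> nat) \<Rightarrow> (nat \<Rightarrow> nat \<Rightarrow> int) \<Rightarrow> (nat \<Rightarrow> nat set) set" where
  "C_nat n k a = {S \<in> min_Sol n k a. \<forall>j\<in>{1..n}. ord_set (S j) \<ge> enat (k j)}"

definition C_supp :: "nat \<Rightarrow> (nat \<Rightarrow> nat) \<Rightarrow> (nat \<Rightarrow> nat \<Rightarrow> int) \<Rightarrow> nat set set" where
  "C_supp n k a = supp n ` C_nat n k a"

definition L_set :: "nat \<Rightarrow> (nat \<Rightarrow> nat) \<Rightarrow> (nat \<Rightarrow> nat \<Rightarrow> int) \<Rightarrow> nat set" where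
  "L_set n k a =
     {j \<in> {1..n}. min_attained_twice {0..k j} (\<lambda>i. a i j + int (k j) - int i)}"

section \<open>Matroids\<close>

text \<open>Matroids on a finite ground set \<open>E\<close>, given by their family \<open>\<I>\<close> of independent sets.\<close>

definition matroid :: "'a set \<Rightarrow> 'a set set \<Rightarrow> bool" where
  "matroid E \<I> \<longleftrightarrow> finite E \<and> \<I> \<subseteq> Pow E \<and> {} \<in> \<I> \<and>
     (\<forall>X\<in>\<I>. \<forall>Y. Y \<subseteq> X \<longrightarrow> Y \<in> \<I>) \<and>
     (\<forall>X\<in>\<I>. \<forall>Y\<in>\<I>. card X < card Y \<longrightarrow> (\<exists>y\<in>Y - X. insert y X \<in> \<I>))"

definition circuits :: "'a set \<Rightarrow> 'a set set \<Rightarrow> 'a set set" where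
  "circuits E \<I> = {C. C \<subseteq> E \<and> C \<notin> \<I> \<and> (\<forall>D. D \<subset> C \<longrightarrow> D \<in> \<I>)}"

definition loops :: "'a set \<Rightarrow> 'a set set \<Rightarrow> 'a set" where
  "loops E \<I> = {e \<in> E. {e} \<in> circuits E \<I>}"

end

theory Submission
  imports Defs
begin

text \<open>
  If every \<open>S j\<close> has all its elements \<open>\<ge> k j\<close>, then \<open>val (S j) i = s j - i\<close> for \<open>i \<le> k j\<close>, where
  \<open>s j\<close> is the least element of \<open>S j\<close>.  Hence only the support \<open>J\<close> of \<open>S\<close> and the least elements
  matter: a nonzero \<open>S\<close> is a solution iff the finite integer family \<open>a i j + s j - i\<close>, indexed by
  \<open>j \<in> J\<close>, \<open>i \<le> k j\<close>, attains its minimum twice (\<open>point_tuple_Sol_iff\<close>, \<open>reduce_in_Sol\<close>).  A minimal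
  solution of this kind therefore has at most one point in each component (\<open>C_nat_point_tuple\<close>),
  and a solution with one point in each component of \<open>J\<close> is minimal iff no nonempty proper subset
  of \<open>J\<close> is balanced, that is, also gives a solution (\<open>point_tuple_C_nat_iff\<close>).

  Column \<open>j\<close> on its own attains its minimum twice iff \<open>j \<in> L(P)\<close>, whatever \<open>s j\<close> is
  (\<open>balanced_singleton_iff\<close>).  So a balanced \<open>J\<close> contains either a loop \<open>j\<close>, with \<open>{j}\<close> balanced, or
  two indices whose column minima agree with the overall minimum, and these two form a balanced pair
  (\<open>balanced_contains_circuit\<close>).  Conversely, two columns outside \<open>L(P)\<close> can be brought
  to the same minimum by shifting the points \<open>s j\<close> upwards (\<open>exists_balanced_pair\<close>).

  A family consisting of the singletons in \<open>L\<close> and the pairs outside \<open>L\<close> is the family of circuits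
  of the matroid of rank at most one whose independent sets are \<open>{}\<close> and the \<open>{j}\<close> with \<open>j \<notin> L\<close>.
\<close>

section \<open>Minima attained twice\<close>

lemma min_attained_twice_iff:
  fixes f :: "'i \<Rightarrow> 'b::linorder"
  assumes "finite I"
  shows "min_attained_twice I f \<longleftrightarrow>
    (\<exists>p\<in>I. \<exists>q\<in>I. p \<noteq> q \<and> f p = f q \<and> (\<forall>r\<in>I. f p \<le> f r))"
proof
  assume "min_attained_twice I f"
  then have c: "2 \<le> card {p \<in> I. f p = Min (f ` I)}"
    by (simp add: min_attained_twice_def)
  then obtain B where "B \<subseteq> {p \<in> I. f p = Min (f ` I)}" "card B = 2"
    by (rule obtain_subset_with_card_n)
  then obtain p q where pq: "p \<noteq> q" "{p, q} \<subseteq> {p \<in> I. f p = Min (f ` I)}"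
    by (auto simp: card_2_iff)
  moreover have "\<forall>r\<in>I. Min (f ` I) \<le> f r"
    using assms by simp
  ultimately show "\<exists>p\<in>I. \<exists>q\<in>I. p \<noteq> q \<and> f p = f q \<and> (\<forall>r\<in>I. f p \<le> f r)"
    by (intro bexI[of _ p] bexI[of _ q]) auto
next
  assume "\<exists>p\<in>I. \<exists>q\<in>I. p \<noteq> q \<and> f p = f q \<and> (\<forall>r\<in>I. f p \<le> f r)"
  then obtain p q where pq: "p \<in> I" "q \<in> I" "p \<noteq> q" "f p = f q" "\<forall>r\<in>I. f p \<le> f r"
    by blast
  then have "Min (f ` I) = f p"
    using assms by (intro Min_eqI) auto
  then have "{p, q} \<subseteq> {p \<in> I. f p = Min (f ` I)}"
    using pq by auto
  then have "card {p, q} \<le> card {p \<in> I. f p = Min (f ` I)}"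
    using assms by (intro card_mono) auto
  then show "min_attained_twice I f"
    using pq(3) by (simp add: min_attained_twice_def)
qed

section \<open>Tuples with at most one point in each component\<close>

text \<open>The tuple with components \<open>{s j}\<close> for \<open>j \<in> J\<close> and \<open>{}\<close> for the other \<open>j\<close> in \<open>{1..n}\<close>.\<close>

definition point_tuple :: "nat \<Rightarrow> (nat \<Rightarrow> nat) \<Rightarrow> nat set \<Rightarrow> nat \<Rightarrow> nat set" where
  "point_tuple n s J = (\<lambda>j\<in>{1..n}. if j \<in> J then {s j} else {})"

text \<open>
  The equation restricted to the unknowns in \<open>J\<close>, evaluated at the singletons \<open>{s j}\<close>, attains its
  minimum at least twice.  The terms are written as integers, which agrees with their tropical
  values only if \<open>k j \<le> s j\<close> for all \<open>j \<in> J\<close>.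
\<close>

definition balanced :: "(nat \<Rightarrow> nat) \<Rightarrow> (nat \<Rightarrow> nat \<Rightarrow> int) \<Rightarrow> (nat \<Rightarrow> nat) \<Rightarrow> nat set \<Rightarrow> bool" where
  "balanced k a s J \<longleftrightarrow>
     (\<exists>j\<in>J. \<exists>i\<le>k j. \<exists>j'\<in>J. \<exists>i'\<le>k j'. (i, j) \<noteq> (i', j') \<and>
        a i j + int (s j) - int i = a i' j' + int (s j') - int i' \<and>
        (\<forall>l\<in>J. \<forall>h\<le>k l. a i j + int (s j) - int i \<le> a h l + int (s l) - int h))"

lemma finite_index_pairs: "finite (index_pairs n k)"
proof -
  have "index_pairs n k = (\<lambda>(j, i). (i, j)) ` (SIGMA j:{1..n}. {0..k j})"
    by (auto simp: index_pairs_def image_iff)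
  then show ?thesis by simp
qed

lemma val_empty: "val {} i = \<infinity>"
  by (simp add: val_def top_enat_def)

lemma val_least:
  assumes "s \<in> S" "i \<le> s" "\<And>t. t \<in> S \<Longrightarrow> s \<le> t"
  shows "val S i = enat (s - i)"
  unfolding val_def
proof (rule antisym)
  show "(INF s\<in>{s \<in> S. i \<le> s}. enat (s - i)) \<le> enat (s - i)"
    using assms by (intro INF_lower) auto
  show "enat (s - i) \<le> (INF s\<in>{s \<in> S. i \<le> s}. enat (s - i))"
    using assms by (intro INF_greatest) (auto intro: diff_le_mono)
qed

lemma ord_set_ge_iff: "enat m \<le> ord_set T \<longleftrightarrow> (\<forall>t\<in>T. m \<le> t)"
  by (auto simp: ord_set_def le_INF_iff)

lemma point_tuple_simps:
  assumes "J \<subseteq> {1..n}"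
  shows "point_tuple n s J \<in> tuples n"
    and "supp n (point_tuple n s J) = J"
    and "j \<in> {1..n} \<Longrightarrow> point_tuple n s J j = (if j \<in> J then {s j} else {})"
  using assms by (auto simp: point_tuple_def tuples_def supp_def)

lemma tuples_eqI:
  assumes "S \<in> tuples n" "T \<in> tuples n" "\<And>j. j \<in> {1..n} \<Longrightarrow> S j = T j"
  shows "S = T"
  using assms unfolding tuples_def by (metis PiE_ext)

lemma zero_tuple_iff_supp:
  assumes "S \<in> tuples n"
  shows "S = zero_tuple n \<longleftrightarrow> supp n S = {}"
proof
  assume "supp n S = {}"
  then show "S = zero_tuple n"
    using assms by (intro tuples_eqI[of S n]) (auto simp: zero_tuple_def tuples_def supp_def)
qed (auto simp: zero_tuple_def supp_def)

lemma below_point_tuple: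
  assumes "T \<in> tuples n" "tuple_le n T (point_tuple n s J)" "J \<subseteq> {1..n}"
  shows "supp n T \<subseteq> J" "T = point_tuple n s (supp n T)"
proof -
  have sub: "T j \<subseteq> (if j \<in> J then {s j} else {})" if "j \<in> {1..n}" for j
    using assms(2,3) that by (auto simp: tuple_le_def point_tuple_simps)
  show "supp n T \<subseteq> J"
    using sub unfolding supp_def by (force split: if_splits)
  have "supp n T \<subseteq> {1..n}" by (auto simp: supp_def)
  then show "T = point_tuple n s (supp n T)"
  proof (intro tuples_eqI[OF assms(1)])
    fix j assume j: "j \<in> {1..n}"
    from sub[OF j] show "T j = point_tuple n s (supp n T) j"
      using j by (auto simp: point_tuple_def supp_def split: if_splits)
  qed (simp add: point_tuple_simps)
qed

lemma trop_term_point_tuple: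
  assumes "J \<subseteq> {1..n}" "\<forall>j\<in>J. k j \<le> s j" "(i, j) \<in> index_pairs n k"
  shows "trop_term a (point_tuple n s J) (i, j) =
    (if j \<in> J then ereal (of_int (a i j + int (s j) - int i)) else \<infinity>)"
proof (cases "j \<in> J")
  case True
  then have "i \<le> s j"
    using assms by (force simp: index_pairs_def)
  moreover from this have "val {s j} i = enat (s j - i)"
    by (intro val_least) auto
  moreover have "point_tuple n s J j = {s j}"
    using True assms by (simp add: point_tuple_def subset_iff)
  ultimately show ?thesis
    using True by (simp add: trop_term_def of_nat_diff)
next
  case False
  then have "point_tuple n s J j = {}"
    using assms(3) by (simp add: point_tuple_def index_pairs_def)
  then show ?thesis
    using False by (simp add: trop_term_def val_empty)
qed

lemma point_tuple_Sol_iff: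
  assumes J: "J \<subseteq> {1..n}" "J \<noteq> {}" and s: "\<forall>j\<in>J. k j \<le> s j"
  shows "point_tuple n s J \<in> Sol n k a \<longleftrightarrow> balanced k a s J"
proof -
  let ?I = "index_pairs n k" and ?f = "trop_term a (point_tuple n s J)"
  note t = trop_term_point_tuple[OF J(1) s, where a = a]
  have I: "(i, j) \<in> ?I" if "j \<in> J" "i \<le> k j" for i j
    using that J by (auto simp: index_pairs_def)
  obtain j0 where j0: "j0 \<in> J" using J by blast
  have fin: "?f (0, j0) < \<infinity>"
    using t[OF I[OF j0, of 0]] j0 by simp
  moreover have "Min (?f ` ?I) \<le> ?f (0, j0)"
    using finite_index_pairs I[OF j0, of 0] by simp
  ultimately have "Min (?f ` ?I) \<noteq> \<infinity>" by auto
  then have "point_tuple n s J \<in> Sol n k a \<longleftrightarrow> min_attained_twice ?I ?f"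
    using J by (simp add: Sol_def point_tuple_simps)
  also have "\<dots> \<longleftrightarrow> (\<exists>p\<in>?I. \<exists>q\<in>?I. p \<noteq> q \<and> ?f p = ?f q \<and> (\<forall>r\<in>?I. ?f p \<le> ?f r))"
    by (rule min_attained_twice_iff[OF finite_index_pairs])
  also have "\<dots> \<longleftrightarrow> balanced k a s J"
  proof
    assume "\<exists>p\<in>?I. \<exists>q\<in>?I. p \<noteq> q \<and> ?f p = ?f q \<and> (\<forall>r\<in>?I. ?f p \<le> ?f r)"
    then obtain i j i' j' where p: "(i, j) \<in> ?I" "(i', j') \<in> ?I" "(i, j) \<noteq> (i', j')"
      "?f (i, j) = ?f (i', j')" and le: "\<And>r. r \<in> ?I \<Longrightarrow> ?f (i, j) \<le> ?f r"
      by (metis surj_pair)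
    have "?f (i, j) < \<infinity>"
      using le[OF I[OF j0, of 0]] fin by (rule le_less_trans) simp
    then have jJ: "j \<in> J" "j' \<in> J"
      using p t by (auto split: if_splits)
    have "a i j + int (s j) - int i \<le> a h l + int (s l) - int h" if "l \<in> J" "h \<le> k l" for h l
    proof -
      have "real_of_int (a i j + int (s j) - int i) \<le> real_of_int (a h l + int (s l) - int h)"
        using le[OF I[OF that]] t[OF p(1)] t[OF I[OF that]] jJ that by simp
      then show ?thesis unfolding of_int_le_iff .
    qed
    moreover have "a i j + int (s j) - int i = a i' j' + int (s j') - int i'"
    proof -
      have "real_of_int (a i j + int (s j) - int i) = real_of_int (a i' j' + int (s j') - int i')"
        using p(4) t[OF p(1)] t[OF p(2)] jJ by simp
      then show ?thesis unfolding of_int_eq_iff .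
    qed
    moreover have "i \<le> k j" "i' \<le> k j'"
      using p by (auto simp: index_pairs_def)
    ultimately show "balanced k a s J"
      unfolding balanced_def using jJ p(3) by blast
  next
    assume "balanced k a s J"
    then obtain i j i' j' where p: "j \<in> J" "i \<le> k j" "j' \<in> J" "i' \<le> k j'" "(i, j) \<noteq> (i', j')"
        "a i j + int (s j) - int i = a i' j' + int (s j') - int i'"
      and le: "\<And>l h. l \<in> J \<Longrightarrow> h \<le> k l \<Longrightarrow>
        a i j + int (s j) - int i \<le> a h l + int (s l) - int h"
      unfolding balanced_def by blast
    have "?f (i, j) \<le> ?f r" if "r \<in> ?I" for r
    proof -
      obtain h l where r: "r = (h, l)" by (cases r)
      then have "h \<le> k l" using that by (simp add: index_pairs_def)
      show ?thesis
      proof (cases "l \<in> J")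
        case True
        have "real_of_int (a i j + int (s j) - int i) \<le> real_of_int (a h l + int (s l) - int h)"
          unfolding of_int_le_iff by (rule le[OF True \<open>h \<le> k l\<close>])
        then show ?thesis
          using t[OF I[OF p(1,2)]] t[OF I[OF True \<open>h \<le> k l\<close>]] p(1) True r
          by (simp del: of_int_add of_int_diff)
      next
        case False
        then show ?thesis using t that r by simp
      qed
    qed
    moreover have "?f (i, j) = ?f (i', j')"
      unfolding t[OF I[OF p(1,2)]] t[OF I[OF p(3,4)]] using p by (simp only: if_True)
    ultimately show "\<exists>p\<in>?I. \<exists>q\<in>?I. p \<noteq> q \<and> ?f p = ?f q \<and> (\<forall>r\<in>?I. ?f p \<le> ?f r)"
      using p I by blast
  qed
  finally show ?thesis .
qed

text \<open>
  Replacing each nonempty component by its least element does not change any term of the equation,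
  provided that the components have no elements below \<open>k j\<close>.
\<close>

lemma reduce_in_Sol:
  assumes S: "S \<in> Sol n k a" and ge: "\<forall>j\<in>{1..n}. enat (k j) \<le> ord_set (S j)"
  shows "point_tuple n (\<lambda>j. LEAST t. t \<in> S j) (supp n S) \<in> Sol n k a"
proof -
  let ?s = "\<lambda>j. LEAST t. t \<in> S j"
  let ?T = "point_tuple n ?s (supp n S)"
  have sub: "supp n S \<subseteq> {1..n}" by (auto simp: supp_def)
  have eq: "trop_term a ?T p = trop_term a S p" if pI: "p \<in> index_pairs n k" for p
  proof -
    obtain i j where p: "p = (i, j)" by (cases p)
    then have ij: "j \<in> {1..n}" "i \<le> k j" using pI by (auto simp: index_pairs_def)
    have "val (?T j) i = val (S j) i"
    proof (cases "S j = {}")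
      case True
      then show ?thesis using ij by (simp add: point_tuple_def supp_def)
    next
      case False
      then have "?s j \<in> S j" by (metis LeastI ex_in_conv)
      moreover from this have "i \<le> ?s j"
        using ge ij by (meson ord_set_ge_iff order_trans)
      ultimately have "val (S j) i = enat (?s j - i)" "val {?s j} i = enat (?s j - i)"
        by (auto intro!: val_least Least_le)
      then show ?thesis
        using False ij by (simp add: point_tuple_def supp_def)
    qed
    then show ?thesis by (simp add: trop_term_def p)
  qed
  have "trop_term a ?T ` index_pairs n k = trop_term a S ` index_pairs n k"
    using eq by (intro image_cong) auto
  moreover from this have "min_attained_twice (index_pairs n k) (trop_term a ?T) \<longleftrightarrow>
      min_attained_twice (index_pairs n k) (trop_term a S)"
    using eq by (simp add: min_attained_twice_def cong: conj_cong)
  ultimately show ?thesis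
    using S sub by (simp add: Sol_def point_tuple_simps)
qed

section \<open>Minimal solutions\<close>

lemma C_nat_point_tuple:
  assumes "S \<in> C_nat n k a"
  obtains s where "S = point_tuple n s (supp n S)" "\<forall>j\<in>supp n S. k j \<le> s j"
proof -
  let ?s = "\<lambda>j. LEAST t. t \<in> S j"
  let ?T = "point_tuple n ?s (supp n S)"
  have sub: "supp n S \<subseteq> {1..n}" by (auto simp: supp_def)
  from assms have S: "S \<in> Sol n k a" "S \<noteq> zero_tuple n" "S \<in> tuples n"
    and ge: "\<forall>j\<in>{1..n}. enat (k j) \<le> ord_set (S j)"
    and min: "\<And>T. T \<in> Sol n k a \<Longrightarrow> T \<noteq> zero_tuple n \<Longrightarrow> tuple_le n T S \<Longrightarrow> T = S"
    by (auto simp: C_nat_def min_Sol_def Sol_def)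
  have least: "?s j \<in> S j" if "j \<in> supp n S" for j
    using that by (auto simp: supp_def intro: LeastI)
  have "?T \<noteq> zero_tuple n"
    using S sub by (simp add: zero_tuple_iff_supp point_tuple_simps)
  moreover have "tuple_le n ?T S"
    using least sub by (auto simp: tuple_le_def point_tuple_simps)
  ultimately have "S = ?T"
    by (intro min[symmetric] reduce_in_Sol S(1) ge)
  moreover have "\<forall>j\<in>supp n S. k j \<le> ?s j"
  proof
    fix j assume "j \<in> supp n S"
    then have "?s j \<in> S j" "\<forall>t\<in>S j. k j \<le> t"
      using least sub ge unfolding ord_set_ge_iff by (blast, blast)
    then show "k j \<le> ?s j" by (simp only: Ball_def)
  qed
  ultimately show thesis by (rule that)
qed

lemma point_tuple_C_nat_iff:
  assumes J: "J \<subseteq> {1..n}" "J \<noteq> {}" and s: "\<forall>j\<in>J. k j \<le> s j"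
  shows "point_tuple n s J \<in> C_nat n k a \<longleftrightarrow>
    balanced k a s J \<and> (\<forall>K. K \<subset> J \<and> K \<noteq> {} \<longrightarrow> \<not> balanced k a s K)" (is "?l \<longleftrightarrow> ?r")
proof
  assume ?l
  then have sol: "point_tuple n s J \<in> Sol n k a"
    and min: "\<And>T. T \<in> Sol n k a \<Longrightarrow> T \<noteq> zero_tuple n \<Longrightarrow> tuple_le n T (point_tuple n s J) \<Longrightarrow>
      T = point_tuple n s J"
    by (auto simp: C_nat_def min_Sol_def)
  have "\<not> balanced k a s K" if K: "K \<subset> J" "K \<noteq> {}" for K
  proof
    assume "balanced k a s K"
    have K': "K \<subseteq> {1..n}" "\<forall>j\<in>K. k j \<le> s j" using K J s by auto
    have "point_tuple n s K \<in> Sol n k a"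
      using \<open>balanced k a s K\<close> point_tuple_Sol_iff[OF K'(1) K(2) K'(2)] by simp
    moreover have "point_tuple n s K \<noteq> zero_tuple n"
      using K K' by (simp add: zero_tuple_iff_supp point_tuple_simps)
    moreover have "tuple_le n (point_tuple n s K) (point_tuple n s J)"
      using K by (auto simp: tuple_le_def point_tuple_def)
    ultimately have "point_tuple n s K = point_tuple n s J" by (rule min)
    then have "K = J"
      using J K' by (metis point_tuple_simps(2))
    then show False using K by simp
  qed
  then show ?r
    using sol point_tuple_Sol_iff[OF assms] by simp
next
  assume r: ?r
  have "T = point_tuple n s J"
    if T: "T \<in> Sol n k a" "T \<noteq> zero_tuple n" "tuple_le n T (point_tuple n s J)" for T
  proof -
    have "T \<in> tuples n" using T by (simp add: Sol_def)
    then have supp: "supp n T \<noteq> {}" "supp n T \<subseteq> J" "T = point_tuple n s (supp n T)"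
      using T J below_point_tuple zero_tuple_iff_supp by auto
    then have "balanced k a s (supp n T)"
      using T J s point_tuple_Sol_iff[of "supp n T" n k s a] by (metis order_trans subsetD)
    then have "supp n T = J"
      using r supp by blast
    then show ?thesis using supp by simp
  qed
  moreover have "point_tuple n s J \<noteq> zero_tuple n"
    using J by (simp add: zero_tuple_iff_supp point_tuple_simps)
  moreover have "\<forall>j\<in>{1..n}. enat (k j) \<le> ord_set (point_tuple n s J j)"
    using s by (simp add: ord_set_ge_iff point_tuple_def)
  ultimately show ?l
    using r point_tuple_Sol_iff[OF assms] by (auto simp: C_nat_def min_Sol_def)
qed

section \<open>Balanced sets of unknowns\<close>

lemma L_set_iff:
  "j \<in> L_set n k a \<longleftrightarrow> j \<in> {1..n} \<and>
    (\<exists>i\<le>k j. \<exists>i'\<le>k j. i \<noteq> i' \<and> a i j - int i = a i' j - int i' \<and>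
      (\<forall>h\<le>k j. a i j - int i \<le> a h j - int h))"
proof -
  have "a i j + int (k j) - int i \<le> a h j + int (k j) - int h \<longleftrightarrow> a i j - int i \<le> a h j - int h"
    "a i j + int (k j) - int i = a h j + int (k j) - int h \<longleftrightarrow> a i j - int i = a h j - int h" for i h
    by auto
  then show ?thesis
    unfolding L_set_def by (simp add: min_attained_twice_iff Bex_def Ball_def)
qed

text \<open>Shifting the point \<open>s j\<close> changes all terms of column \<open>j\<close> by the same amount.\<close>

lemma balanced_singleton_iff:
  assumes "j \<in> {1..n}"
  shows "balanced k a s {j} \<longleftrightarrow> j \<in> L_set n k a"
proof -
  have "a i j + int (s j) - int i \<le> a h j + int (s j) - int h \<longleftrightarrow> a i j - int i \<le> a h j - int h"
    "a i j + int (s j) - int i = a h j + int (s j) - int h \<longleftrightarrow> a i j - int i = a h j - int h" for i h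
    by auto
  then show ?thesis
    using assms unfolding L_set_iff balanced_def by simp
qed

lemma balanced_contains_circuit:
  assumes "balanced k a s J" "J \<subseteq> {1..n}"
  shows "(\<exists>j\<in>J. j \<in> L_set n k a) \<or>
    (\<exists>j\<in>J. \<exists>j'\<in>J. j \<noteq> j' \<and> balanced k a s {j, j'})"
proof -
  obtain i j i' j' where p: "j \<in> J" "i \<le> k j" "j' \<in> J" "i' \<le> k j'" "(i, j) \<noteq> (i', j')"
      "a i j + int (s j) - int i = a i' j' + int (s j') - int i'"
    and le: "\<And>l h. l \<in> J \<Longrightarrow> h \<le> k l \<Longrightarrow>
      a i j + int (s j) - int i \<le> a h l + int (s l) - int h"
    using assms(1) unfolding balanced_def by blast
  have "balanced k a s {j, j'}"
    unfolding balanced_def using p le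
    by (intro bexI[of _ j] exI[of _ i] conjI bexI[of _ j'] exI[of _ i']) auto
  moreover have "balanced k a s {j} \<longleftrightarrow> j \<in> L_set n k a"
    using p(1) assms(2) by (intro balanced_singleton_iff) auto
  ultimately show ?thesis
    using p(1,3) by (cases "j = j'") auto
qed

lemma exists_balanced_pair:
  assumes "j \<noteq> j'"
  shows "\<exists>s. k j \<le> s j \<and> k j' \<le> s j' \<and> balanced k a s {j, j'}"
proof -
  define m where "m l = Min ((\<lambda>h. a h l - int h) ` {..k l})" for l
  have m_le: "m l \<le> a h l - int h" if "h \<le> k l" for h l
    unfolding m_def using that by (intro Min_le) auto
  have "\<exists>h\<le>k l. m l = a h l - int h" for l
  proof -
    have "m l \<in> (\<lambda>h. a h l - int h) ` {..k l}"
      unfolding m_def by (intro Min_in) auto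
    then show ?thesis by auto
  qed
  then obtain i i' where i: "i \<le> k j" "m j = a i j - int i" "i' \<le> k j'" "m j' = a i' j' - int i'"
    by meson
  \<comment> \<open>The common minimum: the least value that both columns can reach by points \<open>\<ge> k\<close>.\<close>
  define c where "c = max (int (k j) + m j) (int (k j') + m j')"
  define s where "s l = nat (c - m l)" for l
  have s: "int (s j) = c - m j" "int (s j') = c - m j'"
    by (auto simp: s_def c_def)
  then have "k j \<le> s j" "k j' \<le> s j'"
    by (auto simp: c_def)
  moreover have "c \<le> a h l + int (s l) - int h" if "l \<in> {j, j'}" "h \<le> k l" for l h
    using m_le[OF that(2)] that(1) s by auto
  then have "balanced k a s {j, j'}"
    unfolding balanced_def using i s assms
    by (intro bexI[of _ j] exI[of _ i] conjI bexI[of _ j'] exI[of _ i']) auto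
  ultimately show ?thesis by blast
qed

lemma C_supp_eq:
  "C_supp n k a = {{j} | j. j \<in> L_set n k a} \<union> {A. A \<subseteq> {1..n} - L_set n k a \<and> card A = 2}"
  (is "_ = ?R")
proof (rule set_eqI, rule iffI)
  fix J assume "J \<in> C_supp n k a"
  then obtain S where S: "S \<in> C_nat n k a" "J = supp n S"
    by (auto simp: C_supp_def)
  obtain s where s: "S = point_tuple n s J" "\<forall>j\<in>J. k j \<le> s j"
    using C_nat_point_tuple[OF S(1)] S(2) by metis
  have J: "J \<subseteq> {1..n}" using S by (auto simp: supp_def)
  have "S \<in> tuples n" "S \<noteq> zero_tuple n"
    using S by (auto simp: C_nat_def min_Sol_def Sol_def)
  then have "J \<noteq> {}" using S(2) zero_tuple_iff_supp by blast
  moreover have "point_tuple n s J \<in> C_nat n k a"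
    using S(1) unfolding s(1) .
  ultimately have bal: "balanced k a s J"
    and min: "\<And>K. K \<subseteq> J \<Longrightarrow> K \<noteq> {} \<Longrightarrow> balanced k a s K \<Longrightarrow> K = J"
    unfolding point_tuple_C_nat_iff[OF J \<open>J \<noteq> {}\<close> s(2)] by (blast, blast)
  have loop: "J = {j}" if "j \<in> J" "j \<in> L_set n k a" for j
    using min[of "{j}"] that J balanced_singleton_iff[of j n k a s] by auto
  show "J \<in> ?R"
  proof (cases "J \<inter> L_set n k a = {}")
    case True
    then obtain j j' where "j \<in> J" "j' \<in> J" "j \<noteq> j'" "balanced k a s {j, j'}"
      using balanced_contains_circuit[OF bal J] by blast
    then have "J = {j, j'}" "j \<noteq> j'" using min[of "{j, j'}"] by auto
    then show ?thesis using True J by auto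
  next
    case False
    then show ?thesis using loop by blast
  qed
next
  fix J assume "J \<in> ?R"
  then consider j where "J = {j}" "j \<in> L_set n k a"
    | "J \<subseteq> {1..n} - L_set n k a" "card J = 2" by auto
  then obtain s where "J \<subseteq> {1..n}" "J \<noteq> {}" "\<forall>j\<in>J. k j \<le> s j" "balanced k a s J"
    "\<forall>K. K \<subset> J \<and> K \<noteq> {} \<longrightarrow> \<not> balanced k a s K"
  proof cases
    case 1
    moreover have "j \<in> {1..n}" using 1 by (simp add: L_set_def)
    ultimately show thesis
      using that[of k] balanced_singleton_iff[of j n k a k] by auto
  next
    case 2
    then obtain j j' where J: "J = {j, j'}" "j \<noteq> j'" by (auto simp: card_2_iff)
    obtain s where s: "k j \<le> s j" "k j' \<le> s j'" "balanced k a s {j, j'}"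
      using exists_balanced_pair[OF J(2)] by blast
    have "\<not> balanced k a s K" if "K \<subset> J" "K \<noteq> {}" for K
    proof -
      have "K = {j} \<or> K = {j'}" using that J by auto
      then show ?thesis
        using 2 J balanced_singleton_iff[of _ n k a s] by auto
    qed
    then show thesis using that[of s] s J 2 by auto
  qed
  then have "point_tuple n s J \<in> C_nat n k a" "supp n (point_tuple n s J) = J"
    by (simp_all add: point_tuple_C_nat_iff point_tuple_simps)
  then show "J \<in> C_supp n k a"
    unfolding C_supp_def by (metis image_eqI)
qed

section \<open>Matroids of rank at most one\<close>

lemma matroid_rank_le_one:
  assumes "finite E"
  shows "matroid E (insert {} {{j} | j. j \<in> E - L})"
proof -
  have "\<exists>y\<in>Y - X. insert y X \<in> insert {} {{j} | j. j \<in> E - L}"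
    if "X \<in> insert {} {{j} | j. j \<in> E - L}" "Y \<in> insert {} {{j} | j. j \<in> E - L}" "card X < card Y"
    for X Y
    using that by auto
  moreover have "Y \<in> insert {} {{j} | j. j \<in> E - L}"
    if "X \<in> insert {} {{j} | j. j \<in> E - L}" "Y \<subseteq> X" for X Y
    using that by (auto simp: subset_singleton_iff)
  ultimately show ?thesis
    using assms unfolding matroid_def by (intro conjI ballI allI impI) auto
qed

lemma circuits_rank_le_one:
  assumes "L \<subseteq> E"
  shows "circuits E (insert {} {{j} | j. j \<in> E - L}) =
    {{j} | j. j \<in> L} \<union> {A. A \<subseteq> E - L \<and> card A = 2}" (is "circuits E ?I = ?R")
proof (rule set_eqI, rule iffI)
  fix C assume "C \<in> circuits E ?I"
  then have C: "C \<subseteq> E" "C \<notin> ?I" and min: "\<And>D. D \<subset> C \<Longrightarrow> D \<in> ?I"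
    by (auto simp: circuits_def)
  show "C \<in> ?R"
  proof (cases "C \<inter> L = {}")
    case False
    then obtain j where j: "j \<in> C" "j \<in> L" by auto
    then have "\<not> {j} \<subset> C" using min[of "{j}"] by auto
    then show ?thesis using j by auto
  next
    case True
    obtain x where x: "x \<in> C" using C by auto
    then have "C \<noteq> {x}" using C True by auto
    then obtain y where y: "y \<in> C" "y \<noteq> x" using x by auto
    have "{x, y} \<notin> ?I" using y by auto
    then have "C = {x, y}" using min[of "{x, y}"] x y by auto
    then show ?thesis using y True C by auto
  qed
next
  fix C assume "C \<in> ?R"
  then consider j where "C = {j}" "j \<in> L" | x y where "C = {x, y}" "x \<noteq> y" "C \<subseteq> E - L"
    by (auto simp: card_2_iff)
  then show "C \<in> circuits E ?I"
  proof cases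
    case 1
    then show ?thesis using assms by (auto simp: circuits_def)
  next
    case 2
    have "D \<in> ?I" if "D \<subset> C" for D
    proof -
      have "D = {} \<or> D = {x} \<or> D = {y}" using that 2 by auto
      then show ?thesis using 2 by auto
    qed
    then show ?thesis using 2 by (auto simp: circuits_def)
  qed
qed

section \<open>The matroid of a tropical linear differential equation\<close>

theorem corollary3p25:
  fixes n :: nat and k :: "nat \<Rightarrow> nat" and a :: "nat \<Rightarrow> nat \<Rightarrow> int"
  assumes "n > 1"
    and "\<forall>j\<in>{1..n}. k j > 0"
  shows "(\<exists>\<I>. matroid {1..n} \<I> \<and> circuits {1..n} \<I> = C_supp n k a \<and>
              loops {1..n} \<I> = L_set n k a) \<and>
         C_supp n k a = {{j} | j. j \<in> L_set n k a} \<union>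
                        {A. A \<subseteq> {1..n} - L_set n k a \<and> card A = 2}"
proof (intro conjI exI)
  let ?I = "insert {} {{j} | j. j \<in> {1..n} - L_set n k a}"
  have L: "L_set n k a \<subseteq> {1..n}" by (auto simp: L_set_def)
  show "matroid {1..n} ?I"
    by (rule matroid_rank_le_one) simp
  show "circuits {1..n} ?I = C_supp n k a"
    using circuits_rank_le_one[OF L] C_supp_eq[of n k a] by simp
  show "loops {1..n} ?I = L_set n k a"
    unfolding loops_def circuits_rank_le_one[OF L] using L by auto
qed (rule C_supp_eq)

end
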